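(* (Ordering Theorem.) Let $n\ge2$, let $G$ be a finite Coxeter group of type $A_n$, $B_n$, or $D_{n+1}$ with Coxeter generators $g_1,g_2,\dots$, and let $w$ be a word in the letters $g_1,g_2,\dots$. There exists a word $\tilde w$ in echelon form such that $w\leadsto\tilde w$.
   Context: Generators: $g_1,\dots,g_n$ in types $A_n,B_n$; $g_1,\dots,g_{n+1}$ in type $D_{n+1}$. Relations: all $g_i^2=1$; in type $A_n$, $(g_ig_{i+1})^3=1$ for $1\le i\le n-1$; in type $B_n$, $(g_ig_{i+1})^3=1$ for $1\le i\le n-2$ and $(g_{n-1}g_n)^4=1$; in type $D_{n+1}$, $(g_ig_{i+1})^3=1$ for $1\le i\le n-1$ and $(g_{n-1}g_{n+1})^3=1$; all other pairs of distinct generators commute. Words are finite (possibly empty) sequences of letters; the empty word is denoted $1$. Tent words, for $1\le k\le n-1$: $t_k=g_k\cdots g_{n-1}g_ng_{n-1}\cdots g_k$ in type $B_n$; $t_k=g_k\cdots g_{n-1}g_ng_{n+1}g_{n-1}\cdots g_k$ in type $D_{n+1}$. Admissible transformations on words ($w',w''$ arbitrary words): (1) Cancelling: $w'g_ig_iw''\mapsto w'w''$. (2) Commuting: $w'g_ig_jw''\mapsto w'g_jg_iw''$ if $g_i,g_j$ commute in $G$. (3) Circular: $g_{i_1}\cdots g_{i_k}g_{i_{k+1}}\cdots g_{i_N}\mapsto g_{i_{k+1}}\cdots g_{i_N}g_{i_1}\cdots g_{i_k}$. (4) Replacement: $w'g_ig_{i+1}g_iw''\mapsto w'g_{i+1}g_ig_{i+1}w''$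 for $1\le i\le n-2$ (all types); $w'g_{n-1}g_ng_{n-1}w''\mapsto w'g_ng_{n-1}g_nw''$ in $A_n$ and $D_{n+1}$; $w'g_{n-1}g_{n+1}g_{n-1}w''\mapsto w'g_{n+1}g_{n-1}g_{n+1}w''$ in $D_{n+1}$; and the tent commuting replacements $w't_kg_jw''\mapsto w'g_jt_kw''$ for $k<j\le n-1$ in $B_n$ and $D_{n+1}$; $w't_kg_nw''\mapsto w'g_{n+1}t_kw''$ and $w't_kg_{n+1}w''\mapsto w'g_nt_kw''$ for $k\le n-1$ in $D_{n+1}$; $w't_kg_nw''\mapsto w'g_nt_kw''$ for $k\le n-1$ in $B_n$. $w_1\leadsto w_2$ means that some finite (possibly empty) sequence of admissible transformations takes $w_1$ to $w_2$. A word $w$ is in echelon form if $w=\delta_1\delta_2\cdots\delta_n\delta_{n+1}$ where $\delta_i\in\{1,g_i\}$ if $i\le n$ and $G=A_n$; $\delta_{n+1}=1$ if $G=A_n$ or $G=B_n$; $\delta_n\in\{1,g_n\}$ if $G=B_n$; $\delta_i\in\{1,g_i\}$ for $i\in\{n,n+1\}$ if $G=D_{n+1}$; $\delta_i\in\{1,g_i,t_i\}$ if $i\le n-1$ and $G=B_n$ or $G=D_{n+1}$. *)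

theory Defs
  imports "HOL-Algebra.Group"
begin

text \<open>
  A letter \<open>g\<^sub>i\<close> is represented by its index \<open>i\<close>, a word by a list of indices, and the empty
  word \<open>1\<close> by \<open>[]\<close>. The parameter \<open>n\<close> stands for \<open>A\<^sub>n\<close>, \<open>B\<^sub>n\<close> and \<open>D\<^sub>n\<^sub>+\<^sub>1\<close> respectively,
  so the rank is \<open>n + 1\<close> for \<open>Type_D\<close>; only \<open>n \<ge> 2\<close> is meaningful.
\<close>

datatype coxeter_type = Type_A | Type_B | Type_D

type_synonym word = "nat list"

definition gens :: "coxeter_type \<Rightarrow> nat \<Rightarrow> nat set" where
  "gens T n = (case T of Type_A \<Rightarrow> {1..n} | Type_B \<Rightarrow> {1..n} | Type_D \<Rightarrow> {1..n + 1})"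

text \<open>\<open>(i, j, m)\<close> is a bond if \<open>(g\<^sub>i g\<^sub>j)\<^sup>m = 1\<close> is one of the relations with exponent \<open>m \<ge> 3\<close>.\<close>

definition bonds :: "coxeter_type \<Rightarrow> nat \<Rightarrow> (nat \<times> nat \<times> nat) set" where
  "bonds T n =
    (case T of
       Type_A \<Rightarrow> {(i, i + 1, 3) | i. 1 \<le> i \<and> i \<le> n - 1}
     | Type_B \<Rightarrow> {(i, i + 1, 3) | i. 1 \<le> i \<and> i \<le> n - 2} \<union> {(n - 1, n, 4)}
     | Type_D \<Rightarrow> {(i, i + 1, 3) | i. 1 \<le> i \<and> i \<le> n - 1} \<union> {(n - 1, n + 1, 3)})"

inductive_set relations :: "coxeter_type \<Rightarrow> nat \<Rightarrow> (word \<times> word) set"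
  for T :: coxeter_type and n :: nat where
  square: "i \<in> gens T n \<Longrightarrow> ([i, i], []) \<in> relations T n"
| bond: "i \<in> gens T n \<Longrightarrow> j \<in> gens T n \<Longrightarrow> (i, j, m) \<in> bonds T n
    \<Longrightarrow> (concat (replicate m [i, j]), []) \<in> relations T n"
| commute: "i \<in> gens T n \<Longrightarrow> j \<in> gens T n \<Longrightarrow> i \<noteq> j
    \<Longrightarrow> \<forall>m. (i, j, m) \<notin> bonds T n \<and> (j, i, m) \<notin> bonds T n
    \<Longrightarrow> ([i, j], [j, i]) \<in> relations T n"

text \<open>
  The congruence on words generated by the relations. As the generators are involutions, the
  quotient monoid is the group with this presentation; no letters for inverses are needed.
\<close>

inductive_set word_eq :: "coxeter_type \<Rightarrow> nat \<Rightarrow> (word \<times> word) set"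
  for T :: coxeter_type and n :: nat where
  rel: "(r, s) \<in> relations T n \<Longrightarrow> u \<in> lists (gens T n) \<Longrightarrow> v \<in> lists (gens T n)
    \<Longrightarrow> (u @ r @ v, u @ s @ v) \<in> word_eq T n"
| refl: "u \<in> lists (gens T n) \<Longrightarrow> (u, u) \<in> word_eq T n"
| sym: "(u, v) \<in> word_eq T n \<Longrightarrow> (v, u) \<in> word_eq T n"
| trans: "(u, v) \<in> word_eq T n \<Longrightarrow> (v, w) \<in> word_eq T n \<Longrightarrow> (u, w) \<in> word_eq T n"

definition coxeter_group :: "coxeter_type \<Rightarrow> nat \<Rightarrow> word set monoid" where
  "coxeter_group T n =
    \<lparr>carrier = lists (gens T n) // word_eq T n,
     monoid.mult = (\<lambda>X Y. \<Union>u\<in>X. \<Union>v\<in>Y. word_eq T n `` {u @ v}),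
     one = word_eq T n `` {[]}\<rparr>"

definition generator :: "coxeter_type \<Rightarrow> nat \<Rightarrow> nat \<Rightarrow> word set" where
  "generator T n i = word_eq T n `` {[i]}"

lemma relations_lists:
  assumes "(r, s) \<in> relations T n"
  shows "r \<in> lists (gens T n) \<and> s \<in> lists (gens T n)"
  using assms by cases (auto split: if_splits)

lemma word_eq_lists:
  assumes "(u, v) \<in> word_eq T n"
  shows "u \<in> lists (gens T n) \<and> v \<in> lists (gens T n)"
  using assms
proof induction
  case (rel r s u v)
  then show ?case
    using relations_lists[OF rel(1)] by auto
qed auto

lemma equiv_word_eq: "equiv (lists (gens T n)) (word_eq T n)"
proof (rule equivI)
  show "word_eq T n \<subseteq> lists (gens T n) \<times> lists (gens T n)"
    by (rule subrelI) (use word_eq_lists in blast)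
  show "refl_on (lists (gens T n)) (word_eq T n)"
    by (auto intro!: refl_onI word_eq.refl)
  show "sym (word_eq T n)"
    by (rule symI) (rule word_eq.sym)
  show "trans (word_eq T n)"
    by (rule transI) (rule word_eq.trans)
qed

lemma word_eq_context:
  assumes "(u, v) \<in> word_eq T n" "x \<in> lists (gens T n)" "y \<in> lists (gens T n)"
  shows "(x @ u @ y, x @ v @ y) \<in> word_eq T n"
  using assms(1)
proof induction
  case (rel r s u v)
  have "((x @ u) @ r @ (v @ y), (x @ u) @ s @ (v @ y)) \<in> word_eq T n"
    by (rule word_eq.rel) (use rel assms(2,3) in auto)
  then show ?case by simp
next
  case (refl u)
  then show ?case using assms(2,3) by (intro word_eq.refl) auto
next
  case (sym u v)
  then show ?case by (blast intro: word_eq.sym)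
next
  case (trans u v w)
  then show ?case by (blast intro: word_eq.trans)
qed

lemma word_eq_append:
  assumes "(u, u') \<in> word_eq T n" "(v, v') \<in> word_eq T n"
  shows "(u @ v, u' @ v') \<in> word_eq T n"
proof (rule word_eq.trans)
  show "(u @ v, u' @ v) \<in> word_eq T n"
    using word_eq_context[OF assms(1), of "[]" v] word_eq_lists[OF assms(2)] by simp
  show "(u' @ v, u' @ v') \<in> word_eq T n"
    using word_eq_context[OF assms(2), of u' "[]"] word_eq_lists[OF assms(1)] by simp
qed

lemma coxeter_group_mult:
  assumes "u \<in> lists (gens T n)" "v \<in> lists (gens T n)"
  shows "word_eq T n `` {u} \<otimes>\<^bsub>coxeter_group T n\<^esub> word_eq T n `` {v} = word_eq T n `` {u @ v}"
proof -
  let ?U = "word_eq T n `` {u}" and ?V = "word_eq T n `` {v}"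
  have "word_eq T n `` {a @ b} = word_eq T n `` {u @ v}" if "a \<in> ?U" "b \<in> ?V" for a b
  proof -
    have "(u @ v, a @ b) \<in> word_eq T n"
      by (rule word_eq_append) (use that in auto)
    from equiv_class_eq[OF equiv_word_eq this] show ?thesis by (rule HOL.sym)
  qed
  then have "(\<Union>a\<in>?U. \<Union>b\<in>?V. word_eq T n `` {a @ b})
      = (\<Union>a\<in>?U. \<Union>b\<in>?V. word_eq T n `` {u @ v})"
    by (intro SUP_cong HOL.refl)
  also have "u \<in> ?U" "v \<in> ?V"
    using assms by (auto intro: word_eq.refl)
  then have "(\<Union>a\<in>?U. \<Union>b\<in>?V. word_eq T n `` {u @ v}) = word_eq T n `` {u @ v}"
    by blast
  finally show ?thesis
    unfolding coxeter_group_def by simp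
qed

lemma word_eq_rev_cancel:
  assumes "u \<in> lists (gens T n)"
  shows "(rev u @ u, []) \<in> word_eq T n"
  using assms
proof (induction u)
  case Nil
  then show ?case by (simp add: word_eq.refl)
next
  case (Cons i u)
  then have "(rev u @ [i, i] @ u, rev u @ [] @ u) \<in> word_eq T n"
    by (intro word_eq.rel relations.square) auto
  then show ?case
    using word_eq.trans[OF _ Cons.IH] Cons.prems by simp
qed

lemma group_coxeter_group: "group (coxeter_group T n)"
proof (rule groupI)
  let ?G = "coxeter_group T n" and ?W = "lists (gens T n)"
  have carr: "carrier ?G = ?W // word_eq T n" and one: "\<one>\<^bsub>?G\<^esub> = word_eq T n `` {[]}"
    by (simp_all add: coxeter_group_def)
  show "\<one>\<^bsub>?G\<^esub> \<in> carrier ?G"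
    unfolding carr one by (rule quotientI) simp
  fix X assume "X \<in> carrier ?G"
  then obtain u where u: "u \<in> ?W" "X = word_eq T n `` {u}"
    unfolding carr by (rule quotientE)
  show "\<one>\<^bsub>?G\<^esub> \<otimes>\<^bsub>?G\<^esub> X = X"
    unfolding one u(2) using u(1) by (simp add: coxeter_group_mult)
  have "word_eq T n `` {rev u} \<otimes>\<^bsub>?G\<^esub> X = \<one>\<^bsub>?G\<^esub>"
    unfolding one u(2)
    using u(1) equiv_class_eq[OF equiv_word_eq word_eq_rev_cancel[OF u(1)]]
    by (simp add: coxeter_group_mult in_lists_conv_set)
  moreover have "word_eq T n `` {rev u} \<in> carrier ?G"
    unfolding carr by (rule quotientI) (use u(1) in \<open>simp add: in_lists_conv_set\<close>)
  ultimately show "\<exists>Y\<in>carrier ?G. Y \<otimes>\<^bsub>?G\<^esub> X = \<one>\<^bsub>?G\<^esub>"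
    by blast
  fix Y assume "Y \<in> carrier ?G"
  then obtain v where v: "v \<in> ?W" "Y = word_eq T n `` {v}"
    unfolding carr by (rule quotientE)
  show "X \<otimes>\<^bsub>?G\<^esub> Y \<in> carrier ?G"
    unfolding u(2) v(2) coxeter_group_mult[OF u(1) v(1)] carr
    by (rule quotientI) (use u(1) v(1) in auto)
  fix Z assume "Z \<in> carrier ?G"
  then obtain w where w: "w \<in> ?W" "Z = word_eq T n `` {w}"
    unfolding carr by (rule quotientE)
  show "X \<otimes>\<^bsub>?G\<^esub> Y \<otimes>\<^bsub>?G\<^esub> Z = X \<otimes>\<^bsub>?G\<^esub> (Y \<otimes>\<^bsub>?G\<^esub> Z)"
    unfolding u(2) v(2) w(2) using u(1) v(1) w(1) by (simp add: coxeter_group_mult)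
qed

text \<open>
  The tent word \<open>t\<^sub>k\<close>, for \<open>1 \<le> k \<le> n - 1\<close>. There are no tent words in type \<open>A\<^sub>n\<close>; the value
  there is a dummy that is never used.
\<close>

definition tent :: "coxeter_type \<Rightarrow> nat \<Rightarrow> nat \<Rightarrow> word" where
  "tent T n k =
    (case T of
       Type_A \<Rightarrow> []
     | Type_B \<Rightarrow> [k..<n] @ [n] @ rev [k..<n]
     | Type_D \<Rightarrow> [k..<n] @ [n, n + 1] @ rev [k..<n])"

text \<open>The replacements are directed: the pair \<open>(r, s)\<close> only allows \<open>r\<close> to be replaced by \<open>s\<close>.\<close>

inductive_set replacements :: "coxeter_type \<Rightarrow> nat \<Rightarrow> (word \<times> word) set"
  for T :: coxeter_type and n :: nat where
  braid: "1 \<le> i \<Longrightarrow> i \<le> n - 2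
    \<Longrightarrow> ([i, i + 1, i], [i + 1, i, i + 1]) \<in> replacements T n"
| braid_AD: "T \<in> {Type_A, Type_D}
    \<Longrightarrow> ([n - 1, n, n - 1], [n, n - 1, n]) \<in> replacements T n"
| braid_D: "T = Type_D
    \<Longrightarrow> ([n - 1, n + 1, n - 1], [n + 1, n - 1, n + 1]) \<in> replacements T n"
| tent_BD: "T \<in> {Type_B, Type_D} \<Longrightarrow> 1 \<le> k \<Longrightarrow> k < j \<Longrightarrow> j \<le> n - 1
    \<Longrightarrow> (tent T n k @ [j], [j] @ tent T n k) \<in> replacements T n"
| tent_D1: "T = Type_D \<Longrightarrow> 1 \<le> k \<Longrightarrow> k \<le> n - 1
    \<Longrightarrow> (tent T n k @ [n], [n + 1] @ tent T n k) \<in> replacements T n"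
| tent_D2: "T = Type_D \<Longrightarrow> 1 \<le> k \<Longrightarrow> k \<le> n - 1
    \<Longrightarrow> (tent T n k @ [n + 1], [n] @ tent T n k) \<in> replacements T n"
| tent_B: "T = Type_B \<Longrightarrow> 1 \<le> k \<Longrightarrow> k \<le> n - 1
    \<Longrightarrow> (tent T n k @ [n], [n] @ tent T n k) \<in> replacements T n"

inductive admissible :: "coxeter_type \<Rightarrow> nat \<Rightarrow> word \<Rightarrow> word \<Rightarrow> bool"
  for T :: coxeter_type and n :: nat where
  cancelling: "i \<in> gens T n \<Longrightarrow> admissible T n (w' @ [i, i] @ w'') (w' @ w'')"
| commuting: "i \<in> gens T n \<Longrightarrow> j \<in> gens T n
    \<Longrightarrow> generator T n i \<otimes>\<^bsub>coxeter_group T n\<^esub> generator T n j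
        = generator T n j \<otimes>\<^bsub>coxeter_group T n\<^esub> generator T n i
    \<Longrightarrow> admissible T n (w' @ [i, j] @ w'') (w' @ [j, i] @ w'')"
| circular: "admissible T n (u @ v) (v @ u)"
| replacement: "(r, s) \<in> replacements T n
    \<Longrightarrow> admissible T n (w' @ r @ w'') (w' @ s @ w'')"

definition leads_to :: "coxeter_type \<Rightarrow> nat \<Rightarrow> word \<Rightarrow> word \<Rightarrow> bool" where
  "leads_to T n = (admissible T n)\<^sup>*\<^sup>*"

lemma replacements_lists:
  assumes "n \<ge> 2" "(r, s) \<in> replacements T n"
  shows "r \<in> lists (gens T n) \<and> s \<in> lists (gens T n)"
  using assms(2,1)
  by cases (auto simp: gens_def tent_def split: coxeter_type.splits)

lemma admissible_lists:
  assumes "n \<ge> 2" "admissible T n u v" "u \<in> lists (gens T n)"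
  shows "v \<in> lists (gens T n)"
  using assms(2)
proof cases
  case (replacement r s w' w'')
  then show ?thesis
    using replacements_lists[OF assms(1) replacement(3)] assms(3) by auto
qed (use assms(3) in auto)

text \<open>The possible values of the block \<open>\<delta>\<^sub>i\<close> of an echelon form, for \<open>1 \<le> i \<le> n + 1\<close>.\<close>

definition echelon_blocks :: "coxeter_type \<Rightarrow> nat \<Rightarrow> nat \<Rightarrow> word set" where
  "echelon_blocks T n i =
    (case T of
       Type_A \<Rightarrow> if i \<le> n then {[], [i]} else {[]}
     | Type_B \<Rightarrow> if i \<le> n - 1 then {[], [i], tent T n i} else if i = n then {[], [i]} else {[]}
     | Type_D \<Rightarrow> if i \<le> n - 1 then {[], [i], tent T n i} else {[], [i]})"

definition echelon_form :: "coxeter_type \<Rightarrow> nat \<Rightarrow> word \<Rightarrow> bool" where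
  "echelon_form T n w \<longleftrightarrow>
    (\<exists>\<delta> :: nat \<Rightarrow> word. (\<forall>i\<in>{1..n + 1}. \<delta> i \<in> echelon_blocks T n i) \<and>
      w = concat (map \<delta> [1..<n + 2]))"

end

theory Submission
  imports Defs
begin

text \<open>
  Without circular moves, every word in the letters from \<open>g\<^sub>k\<close> on reduces to \<open>a X b\<close>, where \<open>X\<close> is
  empty, \<open>g\<^sub>k\<close> or \<open>t\<^sub>k\<close> and \<open>a\<close>, \<open>b\<close> only involve later letters. This goes by downward induction
  on \<open>k\<close>: a word \<open>g\<^sub>k u g\<^sub>k\<close> with \<open>u\<close> reduced to \<open>a Y b\<close> becomes \<open>a (g\<^sub>k Y g\<^sub>k) b\<close>, which is
  treated by cancelling, by a braid replacement, or is a tent; and \<open>t\<^sub>k u g\<^sub>k\<close> becomes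
  \<open>u' t\<^sub>k g\<^sub>k\<close>, where two letters \<open>g\<^sub>k\<close> cancel. An echelon form is then built from the left: in
  \<open>\<delta>\<^sub>1 \<dots> \<delta>\<^sub>k\<^sub>-\<^sub>1 a X b\<close> the factor \<open>a\<close> is moved in front of the blocks and from there
  circularly to the end of the word.
\<close>

section \<open>Reductions without circular moves\<close>

inductive linear_step :: "coxeter_type \<Rightarrow> nat \<Rightarrow> word \<Rightarrow> word \<Rightarrow> bool"
  for T :: coxeter_type and n :: nat where
  cancelling: "i \<in> gens T n \<Longrightarrow> linear_step T n (w' @ [i, i] @ w'') (w' @ w'')"
| commuting: "i \<in> gens T n \<Longrightarrow> j \<in> gens T n
    \<Longrightarrow> generator T n i \<otimes>\<^bsub>coxeter_group T n\<^esub> generator T n j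
        = generator T n j \<otimes>\<^bsub>coxeter_group T n\<^esub> generator T n i
    \<Longrightarrow> linear_step T n (w' @ [i, j] @ w'') (w' @ [j, i] @ w'')"
| replacement: "(r, s) \<in> replacements T n
    \<Longrightarrow> linear_step T n (w' @ r @ w'') (w' @ s @ w'')"

abbreviation reduces :: "coxeter_type \<Rightarrow> nat \<Rightarrow> word \<Rightarrow> word \<Rightarrow> bool" where
  "reduces T n \<equiv> (linear_step T n)\<^sup>*\<^sup>*"

declare rtranclp_trans [trans]

lemma linear_step_admissible: "linear_step T n u v \<Longrightarrow> admissible T n u v"
  by (induction rule: linear_step.induct) (rule admissible.intros; assumption)+

lemma reduces_leads_to: "reduces T n u v \<Longrightarrow> leads_to T n u v"
  unfolding leads_to_def
  by (rule rtranclp_mono[THEN predicate2D]) (rule predicate2I, rule linear_step_admissible)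

lemma leads_to_trans: "leads_to T n u v \<Longrightarrow> leads_to T n v w \<Longrightarrow> leads_to T n u w"
  unfolding leads_to_def by (rule rtranclp_trans)

lemma leads_to_rotate: "leads_to T n (u @ v) (v @ u)"
  unfolding leads_to_def by (rule r_into_rtranclp, rule admissible.circular)

text \<open>This is the gain from excluding circular moves: a rotation of u does not induce a
  rotation of x u y, so \<open>admissible\<close> has no such closure under contexts.\<close>

lemma linear_step_context:
  assumes "linear_step T n u v"
  shows "linear_step T n (x @ u @ y) (x @ v @ y)"
  using assms
proof cases
  case (cancelling i w' w'')
  then show ?thesis using linear_step.cancelling[of i T n "x @ w'" "w'' @ y"] by simp
next
  case (commuting i j w' w'')
  then show ?thesis using linear_step.commuting[of i T n j "x @ w'" "w'' @ y"] by simp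
next
  case (replacement r s w' w'')
  then show ?thesis using linear_step.replacement[of r s T n "x @ w'" "w'' @ y"] by simp
qed

lemma reduces_context: "reduces T n u v \<Longrightarrow> reduces T n (x @ u @ y) (x @ v @ y)"
  by (induction rule: rtranclp_induct)
     (auto intro: rtranclp.rtrancl_into_rtrancl linear_step_context)

lemma reduces_append:
  assumes "reduces T n u u'" "reduces T n v v'"
  shows "reduces T n (u @ v) (u' @ v')"
  using reduces_context[OF assms(1), of "[]" v] reduces_context[OF assms(2), of u' "[]"] by simp

lemma reduces_append_left: "reduces T n v v' \<Longrightarrow> reduces T n (u @ v) (u @ v')"
  by (rule reduces_append) auto

lemma reduces_append_right: "reduces T n u u' \<Longrightarrow> reduces T n (u @ v) (u' @ v)"
  by (rule reduces_append) auto

lemma reduces_square: "i \<in> gens T n \<Longrightarrow> reduces T n [i, i] []"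
  using linear_step.cancelling[of i T n "[]" "[]"] by (simp add: r_into_rtranclp)

lemma reduces_replacement: "(r, s) \<in> replacements T n \<Longrightarrow> reduces T n r s"
  using linear_step.replacement[of r s T n "[]" "[]"] by (simp add: r_into_rtranclp)

text \<open>A commuting move demands an equation in \<open>coxeter_group\<close>. Without a bond it
  is a defining relation, hence an equality of classes under \<open>word_eq\<close>.\<close>

lemma reduces_commute:
  assumes "i \<in> gens T n" "j \<in> gens T n" "i \<noteq> j"
    and "\<And>m. (i, j, m) \<notin> bonds T n" "\<And>m. (j, i, m) \<notin> bonds T n"
  shows "reduces T n [i, j] [j, i]"
proof -
  have "([] @ [i, j] @ [], [] @ [j, i] @ []) \<in> word_eq T n"
    by (rule word_eq.rel, rule relations.commute) (use assms in auto)
  then have "word_eq T n `` {[i] @ [j]} = word_eq T n `` {[j] @ [i]}"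
    using equiv_class_eq[OF equiv_word_eq] by simp
  then have "generator T n i \<otimes>\<^bsub>coxeter_group T n\<^esub> generator T n j
      = generator T n j \<otimes>\<^bsub>coxeter_group T n\<^esub> generator T n i"
    unfolding generator_def using assms(1,2) by (simp add: coxeter_group_mult)
  from linear_step.commuting[OF assms(1,2) this, of "[]" "[]"] show ?thesis
    by (simp add: r_into_rtranclp)
qed

section \<open>Commutation with later letters\<close>

text \<open>
  The letters after \<open>g\<^sub>k\<close>. There are none for \<open>k = n\<close>, even in type \<open>D\<close>: the last two letters are
  treated as a single level.
\<close>

definition upper :: "coxeter_type \<Rightarrow> nat \<Rightarrow> nat \<Rightarrow> nat set" where
  "upper T n k = {j \<in> gens T n. k < j \<and> k < n}"

lemma upper_antimono: "upper T n (Suc k) \<subseteq> upper T n k"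
  by (auto simp: upper_def)

lemma upper_Suc_lists: "u \<in> lists (upper T n (Suc k)) \<Longrightarrow> u \<in> lists (upper T n k)"
  using upper_antimono by (rule subsetD[OF lists_mono])

lemma gens_Icc: "1 \<le> i \<Longrightarrow> i \<le> n \<Longrightarrow> i \<in> gens T n"
  by (auto simp: gens_def split: coxeter_type.split)

text \<open>Here j is at least i + 2, so no bond between neighbours applies. Membership in
  \<open>upper\<close> gives k < n, so i is at most n - 2, which excludes the branch bond (n - 1, n
  + 1) of type D.\<close>

lemma reduces_commute_upper:
  assumes "1 \<le> i" "i < k" "j \<in> upper T n k"
  shows "reduces T n [i, j] [j, i]" "reduces T n [j, i] [i, j]"
proof -
  have "i \<in> gens T n" "j \<in> gens T n" "i \<noteq> j"
    "\<And>m. (i, j, m) \<notin> bonds T n" "\<And>m. (j, i, m) \<notin> bonds T n"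
    using assms by (auto simp: upper_def bonds_def gens_def split: coxeter_type.splits)
  then show "reduces T n [i, j] [j, i]" "reduces T n [j, i] [i, j]"
    by (auto intro: reduces_commute)
qed

lemma reduces_commute_word:
  assumes "1 \<le> i" "i < k" "u \<in> lists (upper T n k)"
  shows "reduces T n ([i] @ u) (u @ [i])" "reduces T n (u @ [i]) ([i] @ u)"
proof -
  show "reduces T n ([i] @ u) (u @ [i])"
    using assms(3)
  proof (induction u)
    case (Cons j u)
    have "reduces T n ([i, j] @ u) ([j, i] @ u)"
      by (rule reduces_append_right) (use Cons assms reduces_commute_upper in auto)
    also have "reduces T n \<dots> ([j] @ u @ [i])"
      using reduces_append_left[of T n "[i] @ u" "u @ [i]" "[j]"] Cons by simp
    finally show ?case by simp
  qed simp
  show "reduces T n (u @ [i]) ([i] @ u)"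
    using assms(3)
  proof (induction u)
    case (Cons j u)
    have "reduces T n ([j] @ u @ [i]) ([j] @ [i] @ u)"
      by (rule reduces_append_left) (use Cons in auto)
    also have "reduces T n \<dots> ([i, j] @ u)"
      using reduces_append_right[of T n "[j, i]" "[i, j]" u] Cons assms reduces_commute_upper by simp
    finally show ?case by simp
  qed simp
qed

section \<open>Words that move past later letters\<close>

text \<open>The word u may change on the way, because a tent in type D exchanges g_n and g_{n+1};
  only its alphabet S is kept.\<close>

definition passes :: "coxeter_type \<Rightarrow> nat \<Rightarrow> nat set \<Rightarrow> word \<Rightarrow> bool" where
  "passes T n S X \<longleftrightarrow> (\<forall>u\<in>lists S. \<exists>u'\<in>lists S. reduces T n (X @ u) (u' @ X))"

lemma passesE:
  assumes "passes T n S X" "u \<in> lists S"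
  obtains u' where "u' \<in> lists S" "reduces T n (X @ u) (u' @ X)"
  using assms unfolding passes_def by blast

lemma passes_Nil: "passes T n S []"
  by (auto simp: passes_def)

lemma passes_append:
  assumes "passes T n S X" "passes T n S Y"
  shows "passes T n S (X @ Y)"
  unfolding passes_def
proof
  fix u assume "u \<in> lists S"
  with assms(2) obtain u' where u': "u' \<in> lists S" "reduces T n (Y @ u) (u' @ Y)"
    by (rule passesE)
  from assms(1) u'(1) obtain u'' where u'': "u'' \<in> lists S" "reduces T n (X @ u') (u'' @ X)"
    by (rule passesE)
  have "reduces T n (X @ Y @ u) (X @ u' @ Y)"
    by (rule reduces_append_left) (rule u'(2))
  also have "reduces T n \<dots> (u'' @ X @ Y)"
    using reduces_append_right[OF u''(2), of Y] by simp
  finally show "\<exists>u'\<in>lists S. reduces T n ((X @ Y) @ u) (u' @ X @ Y)"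
    using u''(1) by auto
qed

lemma passes_concat: "(\<And>X. X \<in> set Xs \<Longrightarrow> passes T n S X) \<Longrightarrow> passes T n S (concat Xs)"
  by (induction Xs) (auto intro: passes_Nil passes_append)

lemma passes_letterI:
  assumes "\<And>j. j \<in> S \<Longrightarrow> \<exists>j'\<in>S. reduces T n (X @ [j]) ([j'] @ X)"
  shows "passes T n S X"
  unfolding passes_def
proof
  fix u assume "u \<in> lists S"
  then show "\<exists>u'\<in>lists S. reduces T n (X @ u) (u' @ X)"
  proof (induction u)
    case (Cons j u)
    then obtain u' where u': "u' \<in> lists S" "reduces T n (X @ u) (u' @ X)" by blast
    from assms Cons.hyps obtain j' where j': "j' \<in> S" "reduces T n (X @ [j]) ([j'] @ X)" by blast
    have "reduces T n ((X @ [j]) @ u) (([j'] @ X) @ u)"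
      by (rule reduces_append_right) (rule j'(2))
    also have "reduces T n \<dots> ([j'] @ u' @ X)"
      using reduces_append_left[OF u'(2), of "[j']"] by simp
    finally show ?case
      using u'(1) j'(1) by (intro bexI[of _ "j' # u'"]) auto
  next
    case Nil
    show ?case by (intro bexI[of _ "[]"]) auto
  qed
qed

text \<open>Each later letter has its own tent replacement. The exchange of g_n and g_{n+1} in type
  D stays inside \<open>upper T n k\<close>, which contains both or neither. The case i = k serves
  words t_k u g_k, and i < k serves blocks already placed.\<close>

lemma tent_passes:
  assumes "T \<noteq> Type_A" "1 \<le> i" "i \<le> k"
  shows "passes T n (upper T n k) (tent T n i)"
proof (rule passes_letterI)
  fix j assume j: "j \<in> upper T n k"
  then have kn: "k < n" and kj: "k < j" by (auto simp: upper_def)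
  have *: "j \<le> n - 1 \<or> j = n \<or> T = Type_D \<and> j = n + 1"
    using j by (cases T) (auto simp: upper_def gens_def)
  consider "j \<le> n - 1" | "T = Type_B" "j = n" | "T = Type_D" "j = n" | "T = Type_D" "j = n + 1"
    using * assms(1) by (cases T) auto
  then have "\<exists>j'\<in>upper T n k. (tent T n i @ [j], [j'] @ tent T n i) \<in> replacements T n"
  proof cases
    case 1
    then have "(tent T n i @ [j], [j] @ tent T n i) \<in> replacements T n"
      by (intro replacements.tent_BD) (use assms kj in \<open>cases T; auto\<close>)+
    with j show ?thesis by blast
  next
    case 2
    then have "(tent T n i @ [j], [j] @ tent T n i) \<in> replacements T n"
      using replacements.tent_B[of T i n] assms kn by simp
    with j show ?thesis by blast
  next
    case 3
    then have "(tent T n i @ [j], [n + 1] @ tent T n i) \<in> replacements T n"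
      using replacements.tent_D1[of T i n] assms kn by simp
    moreover have "n + 1 \<in> upper T n k" using 3 kn by (auto simp: upper_def gens_def)
    ultimately show ?thesis by blast
  next
    case 4
    then have "(tent T n i @ [j], [n] @ tent T n i) \<in> replacements T n"
      using replacements.tent_D2[of T i n] assms kn by simp
    moreover have "n \<in> upper T n k" using 4 kn by (auto simp: upper_def gens_def)
    ultimately show ?thesis by blast
  qed
  then show "\<exists>j'\<in>upper T n k. reduces T n (tent T n i @ [j]) ([j'] @ tent T n i)"
    by (auto intro: reduces_replacement)
qed

lemma letter_passes:
  assumes "1 \<le> i" "i < k"
  shows "passes T n (upper T n k) [i]"
  unfolding passes_def using reduces_commute_word(1)[OF assms] by blast

section \<open>Splitting a word at one level\<close>

text \<open>
  For \<open>k = n\<close> the definition of \<open>tent\<close> still makes sense: it gives \<open>g\<^sub>n\<close> in type \<open>B\<close> and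
  \<open>g\<^sub>n g\<^sub>n\<^sub>+\<^sub>1\<close> in type \<open>D\<close>.
\<close>

definition core :: "coxeter_type \<Rightarrow> nat \<Rightarrow> nat \<Rightarrow> word set" where
  "core T n k = {[], [k]} \<union> (if T = Type_A then {} else {tent T n k})
    \<union> (if T = Type_D \<and> k = n then {[n + 1]} else {})"

lemma core_simps [simp]: "[] \<in> core T n k" "[k] \<in> core T n k"
  by (auto simp: core_def)

lemma core_eq_echelon_blocks: "k < n \<Longrightarrow> core T n k = echelon_blocks T n k"
  by (cases T) (auto simp: core_def echelon_blocks_def)

text \<open>For k = n - 1 the inner factor is \<open>tent T n n\<close>, so the first true tents
  arise from the top level in the same way as all others.\<close>

lemma tent_Suc:
  assumes "k < n" "T \<noteq> Type_A"
  shows "tent T n k = [k] @ tent T n (Suc k) @ [k]"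
  using assms by (cases T) (auto simp: tent_def upt_conv_Cons)

text \<open>In the group this is a double coset decomposition with respect to the subgroup generated
  by the later letters; \<open>core\<close> lists the representatives.\<close>

definition splits :: "coxeter_type \<Rightarrow> nat \<Rightarrow> nat \<Rightarrow> word \<Rightarrow> bool" where
  "splits T n k w \<longleftrightarrow> (\<exists>a\<in>lists (upper T n k). \<exists>X\<in>core T n k. \<exists>b\<in>lists (upper T n k).
    reduces T n w (a @ X @ b))"

lemma splitsI:
  "a \<in> lists (upper T n k) \<Longrightarrow> X \<in> core T n k \<Longrightarrow> b \<in> lists (upper T n k)
    \<Longrightarrow> reduces T n w (a @ X @ b) \<Longrightarrow> splits T n k w"
  unfolding splits_def by blast

lemma splitsE:
  assumes "splits T n k w"
  obtains a X b where "a \<in> lists (upper T n k)" "X \<in> core T n k" "b \<in> lists (upper T n k)"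
    "reduces T n w (a @ X @ b)"
  using assms unfolding splits_def by blast

lemma splits_reduces:
  assumes "reduces T n w w'" "splits T n k w'"
  shows "splits T n k w"
  using assms(2) by (rule splitsE) (blast intro: splitsI rtranclp_trans[OF assms(1)])

lemma splits_context:
  assumes "splits T n k w" "u \<in> lists (upper T n k)" "v \<in> lists (upper T n k)"
  shows "splits T n k (u @ w @ v)"
  using assms(1)
proof (rule splitsE)
  fix a X b
  assume *: "a \<in> lists (upper T n k)" "X \<in> core T n k" "b \<in> lists (upper T n k)"
    "reduces T n w (a @ X @ b)"
  show ?thesis
    by (rule splitsI[of "u @ a" _ _ _ X "b @ v"])
      (use * assms(2,3) reduces_context[OF *(4), of u v] in auto)
qed

lemma splits_core:
  assumes "X \<in> core T n k"
  shows "splits T n k X"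
  by (rule splitsI[of "[]" _ _ _ X "[]"]) (use assms in auto)

text \<open>A braid replacement turns g_k g_j g_k into g_j g_k g_j, whose outer letters belong to
  the flanks. An inner tent grows into the next tent.\<close>

lemma splits_sandwich:
  assumes "1 \<le> k" "k < n" "Y \<in> core T n (Suc k)"
  shows "splits T n k ([k] @ Y @ [k])"
proof -
  have k: "k \<in> gens T n" using assms by (auto intro: gens_Icc)
  have braid: "splits T n k [k, j, k]"
    if "([k, j, k], [j, k, j]) \<in> replacements T n" "j \<in> upper T n k" for j
    by (rule splitsI[of "[j]" _ _ _ "[k]" "[j]"]) (use that reduces_replacement[OF that(1)] in auto)
  have up: "Suc k \<in> upper T n k"
    using assms by (auto simp: upper_def intro: gens_Icc)
  \<comment> \<open>In type B with \<open>Suc k = n\<close> the word g_n equals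
    \<open>tent T n n\<close> and falls under the second case: g_k g_n g_k admits no braid
    replacement, but it is itself t_k.\<close>
  consider "Y = []" | "T \<noteq> Type_A" "Y = tent T n (Suc k)"
    | "Y = [Suc k]" "T = Type_B \<longrightarrow> Suc k \<noteq> n" | "T = Type_D" "Suc k = n" "Y = [n + 1]"
    using assms(3) by (cases "T = Type_B \<and> Suc k = n") (auto simp: core_def tent_def split: if_splits)
  then show ?thesis
  proof cases
    case 1
    then show ?thesis
      using splits_reduces[OF reduces_square[OF k] splits_core[of "[]"]] by simp
  next
    case 2
    then show ?thesis
      using splits_core[of "tent T n k" T n k] tent_Suc[of k n T] assms(2) by (simp add: core_def)
  next
    case 3
    have "([k, Suc k, k], [Suc k, k, Suc k]) \<in> replacements T n"
    proof (cases "Suc k = n")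
      case True
      with 3 have "T \<in> {Type_A, Type_D}" by (cases T) auto
      from replacements.braid_AD[OF this, of n] show ?thesis using True by auto
    next
      case False
      then show ?thesis using replacements.braid[of k n T] assms by simp
    qed
    from braid[OF this up] show ?thesis using 3 by simp
  next
    case 4
    have "([k, n + 1, k], [n + 1, k, n + 1]) \<in> replacements T n"
      using replacements.braid_D[OF 4(1), of n] 4(2) by auto
    moreover have "n + 1 \<in> upper T n k"
      using 4 by (auto simp: upper_def gens_def)
    ultimately show ?thesis using braid 4 by simp
  qed
qed

text \<open>Only g_n and, in type D, the commuting letter g_{n+1} occur, so the words in
  \<open>core T n n\<close> represent all group elements at this level and absorb one letter at a
  time.\<close>

lemma splits_top:
  assumes "n \<ge> 1" "w \<in> lists (upper T n (n - 1))"
  shows "splits T n n w"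
  using assms(2)
proof (induction w rule: rev_induct)
  case Nil
  show ?case by (rule splits_core) simp
next
  case (snoc x w)
  then have x: "x \<in> gens T n" "x = n \<or> T = Type_D \<and> x = n + 1"
    using assms(1) by (auto simp: upper_def gens_def split: coxeter_type.splits)
  \<comment> \<open>Both flanks are therefore empty, and splitting at level n means reducing to a
    core word.\<close>
  have "upper T n n = {}" by (auto simp: upper_def)
  with snoc obtain X where X: "X \<in> core T n n" "reduces T n w X"
    by (auto elim!: splitsE)
  have nn: "reduces T n [n, n] []"
    using assms(1) by (intro reduces_square gens_Icc) auto
  have "splits T n n (X @ [x])"
  proof (cases "T = Type_D")
    case False
    then have "x = n" "X = [] \<or> X = [n]"
      using X(1) x by (cases T; auto simp: core_def tent_def)+
    then show ?thesis
      using splits_core[of "[n]"] splits_reduces[OF nn splits_core[of "[]"]] by auto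
  next
    case D: True
    have gens: "n \<in> gens T n" "n + 1 \<in> gens T n"
      using D assms(1) by (auto simp: gens_def)
    have com: "reduces T n [n + 1, n] [n, n + 1]"
      by (rule reduces_commute) (use gens D assms(1) in \<open>auto simp: bonds_def\<close>)
    have ss: "reduces T n [n + 1, n + 1] []"
      by (rule reduces_square) (rule gens)
    have cores: "core T n n = {[], [n], [n, n + 1], [n + 1]}"
      using D by (auto simp: core_def tent_def)
    have "\<exists>X'\<in>core T n n. reduces T n (X @ [x]) X'"
    proof (cases "x = n")
      case True
      have "reduces T n ([n] @ [n + 1, n]) ([n] @ [n, n + 1])"
        by (rule reduces_append_left) (rule com)
      also have "reduces T n \<dots> [n + 1]"
        using reduces_append_right[OF nn, of "[n + 1]"] by simp
      finally show ?thesis using X(1) True com nn unfolding cores by auto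
    next
      case False
      then have "x = n + 1" using x by simp
      moreover have "reduces T n ([n] @ [n + 1, n + 1]) ([n] @ [])"
        by (rule reduces_append_left) (rule ss)
      ultimately show ?thesis using X(1) ss unfolding cores by auto
    qed
    then show ?thesis by (blast intro: splits_reduces splits_core)
  qed
  then show ?case
    by (rule splits_reduces[OF reduces_append_right[OF X(2)]])
qed

text \<open>Letters are appended on the right one by one. A later letter simply joins b, so only an
  appended g_k affects the middle block.\<close>

lemma splits_step:
  assumes k: "1 \<le> k" "k < n"
    and IH: "\<And>u. u \<in> lists (upper T n k) \<Longrightarrow> splits T n (Suc k) u"
    and w: "w \<in> lists (upper T n (k - 1))"
  shows "splits T n k w"
  using w
proof (induction w rule: rev_induct)
  case Nil
  show ?case by (rule splits_core) simp
next
  case (snoc x w)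
  have x: "x = k \<or> x \<in> upper T n k"
    using snoc.prems k by (auto simp: upper_def)
  have kg: "k \<in> gens T n" using k by (auto intro: gens_Icc)
  from snoc have "splits T n k w" by simp
  then obtain a X b where a: "a \<in> lists (upper T n k)" and X: "X \<in> core T n k"
    and b: "b \<in> lists (upper T n k)" and red: "reduces T n w (a @ X @ b)"
    by (rule splitsE)
  have "splits T n k (X @ b @ [x])"
  proof (cases "x = k")
    case False
    then show ?thesis
      using splits_context[OF splits_core[OF X], of "[]" "b @ [x]"] b x by simp
  next
    case True
    consider "X = []" | "X = [k]" | "T \<noteq> Type_A" "X = tent T n k"
      using X k by (auto simp: core_def split: if_splits)
    then show ?thesis
    proof cases
      case 1
      then show ?thesis
        using splits_context[OF splits_core[of "[k]"], of T n k b "[]"] b True by simp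
    next
      case 2
      \<comment> \<open>The flanks c and d lie beyond g_{k+1}, so both copies of g_k pass them and
        enclose Y alone.\<close>
      from IH[OF b] obtain c Y d where c: "c \<in> lists (upper T n (Suc k))"
        and Y: "Y \<in> core T n (Suc k)" and d: "d \<in> lists (upper T n (Suc k))"
        and red: "reduces T n b (c @ Y @ d)"
        by (rule splitsE)
      have "reduces T n ([k] @ b @ [k]) ([k] @ (c @ Y @ d) @ [k])"
        by (rule reduces_context) (rule red)
      also have "\<dots> = ([k] @ c) @ Y @ d @ [k]"
        by simp
      also have "reduces T n \<dots> ((c @ [k]) @ Y @ [k] @ d)"
        by (rule reduces_append[OF reduces_commute_word(1)[OF k(1) lessI c]
              reduces_append_left[OF reduces_commute_word(2)[OF k(1) lessI d]]])
      finally have "reduces T n (X @ b @ [x]) (c @ ([k] @ Y @ [k]) @ d)"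
        using True 2 by simp
      then show ?thesis
        by (rule splits_reduces)
          (rule splits_context[OF splits_sandwich[OF k Y] upper_Suc_lists[OF c] upper_Suc_lists[OF d]])
    next
      case 3
      have "passes T n (upper T n k) X"
        using tent_passes[of T k k n] 3 k by simp
      then obtain b' where b': "b' \<in> lists (upper T n k)" "reduces T n (X @ b) (b' @ X)"
        using b by (rule passesE)
      have up: "tent T n (Suc k) \<in> lists (upper T n k)"
        using k by (cases T) (auto simp: tent_def upper_def gens_def)
      have "reduces T n ((X @ b) @ [k]) ((b' @ X) @ [k])"
        by (rule reduces_append_right) (rule b')
      \<comment> \<open>The tent ends in g_k, which meets the appended g_k. What remains is g_k
        t_{k+1}: its middle block is g_k, and t_{k+1} becomes the right flank.\<close>
      also have "(b' @ X) @ [k] = (b' @ [k] @ tent T n (Suc k)) @ [k, k]"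
        using 3 k tent_Suc[of k n T] by simp
      also have "reduces T n \<dots> ((b' @ [k] @ tent T n (Suc k)) @ [])"
        by (rule reduces_append_left) (rule reduces_square[OF kg])
      finally have "reduces T n (X @ b @ [x]) (b' @ [k] @ tent T n (Suc k))"
        using True by simp
      then show ?thesis
        by (rule splits_reduces) (rule splits_context[OF splits_core[OF core_simps(2)] b'(1) up])
    qed
  qed
  from splits_context[OF this a, of "[]"] have "splits T n k ((a @ X @ b) @ [x])"
    by simp
  then show ?case
    by (rule splits_reduces[OF reduces_append_right[OF red]])
qed

text \<open>The alphabet of letters from g_k on is written with k - 1 so that at k = n it still
  contains g_n and, in type D, g_{n+1}.\<close>

lemma splits_upper:
  assumes "1 \<le> k" "k \<le> n" "w \<in> lists (upper T n (k - 1))"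
  shows "splits T n k w"
  using assms(2,1,3)
proof (induction k arbitrary: w rule: inc_induct)
  case base
  then show ?case by (intro splits_top) auto
next
  case (step k)
  then show ?case by (auto intro!: splits_step[of k n T w])
qed

section \<open>Building the echelon form from the left\<close>

text \<open>The bound k < n leaves the top level for separate treatment, since its core word
  supplies the two blocks \<delta>_n and \<delta>_{n+1}.\<close>

lemma leads_to_partial_echelon:
  assumes "n \<ge> 1" "w \<in> lists (gens T n)" "k < n"
  shows "\<exists>\<delta> v. (\<forall>i\<in>{1..k}. \<delta> i \<in> core T n i) \<and> v \<in> lists (upper T n k)
    \<and> leads_to T n w (concat (map \<delta> [1..<Suc k]) @ v)"
  using assms(3)
proof (induction k)
  case 0
  have "gens T n \<subseteq> upper T n 0"
    using assms(1) by (auto simp: upper_def gens_def split: coxeter_type.splits)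
  then have "w \<in> lists (upper T n 0)"
    using assms(2) by auto
  then show ?case by (auto simp: leads_to_def)
next
  case (Suc k)
  then obtain \<delta> v where \<delta>: "\<forall>i\<in>{1..k}. \<delta> i \<in> core T n i" and v: "v \<in> lists (upper T n k)"
    and wv: "leads_to T n w (concat (map \<delta> [1..<Suc k]) @ v)"
    by auto
  have "splits T n (Suc k) v"
    by (rule splits_upper) (use Suc.prems v in auto)
  then obtain a X b where a: "a \<in> lists (upper T n (Suc k))" and X: "X \<in> core T n (Suc k)"
    and b: "b \<in> lists (upper T n (Suc k))" and red: "reduces T n v (a @ X @ b)"
    by (rule splitsE)
  define P where "P = concat (map \<delta> [1..<Suc k])"
  have "passes T n (upper T n (Suc k)) (\<delta> i)" if "i \<in> {1..k}" for i
  proof -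
    have "\<delta> i = [] \<or> \<delta> i = [i] \<or> T \<noteq> Type_A \<and> \<delta> i = tent T n i"
      using that \<delta> Suc.prems by (auto simp: core_def split: if_splits)
    then show ?thesis
      using that passes_Nil letter_passes[of i "Suc k"] tent_passes[of T i "Suc k"] by auto
  qed
  then have "passes T n (upper T n (Suc k)) P"
    unfolding P_def by (intro passes_concat) auto
  then obtain a' where a': "a' \<in> lists (upper T n (Suc k))" "reduces T n (P @ a) (a' @ P)"
    using a by (rule passesE)
  have "reduces T n (P @ v) (P @ a @ X @ b)"
    by (rule reduces_append_left) (rule red)
  also have "reduces T n \<dots> (a' @ P @ X @ b)"
    using reduces_append_right[OF a'(2), of "X @ b"] by simp
  finally have "leads_to T n (P @ v) (a' @ P @ X @ b)"
    by (simp add: reduces_leads_to)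
  then have "leads_to T n w (a' @ P @ X @ b)"
    using leads_to_trans[OF wv] by (simp add: P_def)
  \<comment> \<open>The single circular move of this level: a' leaves the front and joins b, and b
    a' is the remainder for the next level.\<close>
  then have *: "leads_to T n w (P @ X @ b @ a')"
    using leads_to_trans leads_to_rotate[of T n a' "P @ X @ b"] by force
  let ?\<delta> = "\<delta>(Suc k := X)"
  have "concat (map ?\<delta> [1..<Suc (Suc k)]) = P @ X"
    by (simp add: P_def)
  then have "leads_to T n w (concat (map ?\<delta> [1..<Suc (Suc k)]) @ b @ a')"
    using * by simp
  moreover have "\<forall>i\<in>{1..Suc k}. ?\<delta> i \<in> core T n i"
    using \<delta> X by auto
  moreover have "b @ a' \<in> lists (upper T n (Suc k))"
    using b a' by auto
  ultimately show ?case by blast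
qed

text \<open>Only type D needs a nonempty second factor, for g_{n+1} and g_n g_{n+1}.\<close>

lemma core_top_echelon_blocks:
  assumes "n \<ge> 1" "X \<in> core T n n"
  shows "\<exists>Y Z. X = Y @ Z \<and> Y \<in> echelon_blocks T n n \<and> Z \<in> echelon_blocks T n (n + 1)"
proof -
  have "X = [] \<or> X = [n] \<or> T = Type_D \<and> (X = [n + 1] \<or> X = [n, n + 1])"
    using assms by (cases T) (auto simp: core_def tent_def)
  moreover have "[] \<in> echelon_blocks T n i" for i
    by (simp add: echelon_blocks_def split: coxeter_type.split)
  moreover have "[n] \<in> echelon_blocks T n n"
    using assms(1) by (simp add: echelon_blocks_def split: coxeter_type.split)
  moreover have "T = Type_D \<Longrightarrow> [n + 1] \<in> echelon_blocks T n (n + 1)"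
    by (simp add: echelon_blocks_def)
  ultimately show ?thesis
    by (metis append_Nil append_Nil2 append_Cons)
qed

theorem theorem7p5:
  fixes T :: coxeter_type and n :: nat and w :: word
  assumes "n \<ge> 2" and "w \<in> lists (gens T n)"
  shows "\<exists>w'. echelon_form T n w' \<and> leads_to T n w w'"
proof -
  from leads_to_partial_echelon[of n w T "n - 1"] assms obtain \<delta> v
    where \<delta>: "\<forall>i\<in>{1..n - 1}. \<delta> i \<in> core T n i" and v: "v \<in> lists (upper T n (n - 1))"
      and wv: "leads_to T n w (concat (map \<delta> [1..<n]) @ v)"
    by auto
  have "splits T n n v"
    by (rule splits_upper) (use assms v in auto)
  \<comment> \<open>At level n the flanks are empty, so no further rotation is required.\<close>
  then obtain X where X: "X \<in> core T n n" "reduces T n v X"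
    by (auto elim!: splitsE simp: upper_def)
  from core_top_echelon_blocks[OF _ X(1)] assms(1) obtain Y Z
    where YZ: "X = Y @ Z" "Y \<in> echelon_blocks T n n" "Z \<in> echelon_blocks T n (n + 1)"
    by auto
  let ?\<delta> = "\<delta>(n := Y, n + 1 := Z)"
  have "map ?\<delta> [1..<n] = map \<delta> [1..<n]"
    by auto
  then have "concat (map ?\<delta> [1..<n + 2]) = concat (map \<delta> [1..<n]) @ X"
    using assms(1) YZ(1) by simp
  moreover have "?\<delta> i \<in> echelon_blocks T n i" if "i \<in> {1..n + 1}" for i
  proof -
    from that consider "i \<in> {1..n - 1}" "i < n" | "i = n" | "i = n + 1"
      by fastforce
    then show ?thesis
      using \<delta> YZ(2,3) core_eq_echelon_blocks[of i n T] by cases auto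
  qed
  ultimately have "echelon_form T n (concat (map \<delta> [1..<n]) @ X)"
    unfolding echelon_form_def by metis
  moreover have "leads_to T n w (concat (map \<delta> [1..<n]) @ X)"
    using leads_to_trans[OF wv] reduces_leads_to[OF reduces_append_left[OF X(2)]] by blast
  ultimately show ?thesis by blast
qed

end
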